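(* Let $I\subseteq\mathbb{R}$ be an interval with interior $I^{\circ}$, let $f:I\to\mathbb{R}$ be twice differentiable on $I^{\circ}$, and let $a,b\in I^{\circ}$ with $a<b$ and $f''\in L[a,b]$. Let $s\in(0,1]$ be fixed and suppose that $|f''|$ is $s$-convex in the second sense on $I$. Then for every $\alpha>0$, $$\left|\frac{f(a)+f(b)}{2}-\frac{\Gamma(\alpha+1)}{2(b-a)^{\alpha}}\left[J_{a^{+}}^{\alpha}f(b)+J_{b^{-}}^{\alpha}f(a)\right]\right|\le \frac{(b-a)^{2}}{2(\alpha+1)}\left[\frac{\alpha}{(s+2)(\alpha+s+2)}+\beta(2,s+1)-\beta(\alpha+2,s+1)\right]\left[|f''(a)|+|f''(b)|\right].$$
   Context: Here $L[a,b]$ is the space of Lebesgue integrable functions on $[a,b]$. The Riemann-Liouville fractional integrals of order $\alpha>0$ of $f$ are $J_{a^{+}}^{\alpha}f(x)=\frac{1}{\Gamma(\alpha)}\int_{a}^{x}(x-t)^{\alpha-1}f(t)\,dt$ for $x>a$ and $J_{b^{-}}^{\alpha}f(x)=\frac{1}{\Gamma(\alpha)}\int_{x}^{b}(t-x)^{\alpha-1}f(t)\,dt$ for $x<b$, where $\Gamma(\alpha)=\int_{0}^{\infty}e^{-u}u^{\alpha-1}\,du$ is the Gamma function. $\beta(x,y)=\int_0^1 t^{x-1}(1-t)^{y-1}\,dt$ is the Euler Beta function. A real-valued function $g$ is $s$-convex in the second sense, for a fixed $s\in(0,1]$, if $g(\lambda x+(1-\lambda)y)\le \lambda^{s}g(x)+(1-\lambda)^{s}g(y)$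 for all $x,y$ in its domain and all $\lambda\in[0,1]$. Since $f''$ is only given on $I^{\circ}$, "$|f''|$ is $s$-convex on $I$" means that this inequality holds for $g=|f''|$ and all $x,y\in I^{\circ}$, $\lambda\in[0,1]$. *)

theory Defs
  imports "HOL-Analysis.Analysis"
begin

(* Riemann-Liouville fractional integrals of order \<alpha>, meant for \<alpha> > 0 and for x > a
   (left-sided) resp. x < b (right-sided).  The integrand is singular at t = x if \<alpha> < 1;
   there 0 powr (\<alpha> - 1) = 0, which affects only a null set. *)

definition rl_integral_left :: "real \<Rightarrow> real \<Rightarrow> (real \<Rightarrow> real) \<Rightarrow> real \<Rightarrow> real" where
  "rl_integral_left a \<alpha> f x =
     1 / Gamma \<alpha> * (LINT t:{a..x}|lebesgue. (x - t) powr (\<alpha> - 1) * f t)"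

definition rl_integral_right :: "real \<Rightarrow> real \<Rightarrow> (real \<Rightarrow> real) \<Rightarrow> real \<Rightarrow> real" where
  "rl_integral_right b \<alpha> f x =
     1 / Gamma \<alpha> * (LINT t:{x..b}|lebesgue. (t - x) powr (\<alpha> - 1) * f t)"

(* s-convexity in the second sense on a convex set A, meant for 0 < s \<le> 1; for such s
   the value 0 powr s = 0 is the right one at u = 0 and u = 1. *)

definition s_convex_on :: "real \<Rightarrow> real set \<Rightarrow> (real \<Rightarrow> real) \<Rightarrow> bool" where
  "s_convex_on s A g \<longleftrightarrow>
     (\<forall>x\<in>A. \<forall>y\<in>A. \<forall>u\<in>{0..1}.
        g (u * x + (1 - u) * y) \<le> u powr s * g x + (1 - u) powr s * g y)"

(* Euler's integrals for the library's Gamma and Beta at positive real arguments are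
   Gamma_integral_real and has_integral_Beta_real. *)

end

theory Submission
  imports Defs
begin

text \<open>
  The error of the fractional trapezoid rule is an integral of \<open>f''\<close> against a nonnegative
  kernel. Put \<open>k x = (b - a) powr (\<alpha> + 1) - (x - a) powr (\<alpha> + 1) - (b - x) powr (\<alpha> + 1)\<close>. The second
  derivative of \<open>k\<close> is, up to the factor \<open>-\<alpha> (\<alpha> + 1)\<close>, the sum of the weights
  \<open>(b - x) powr (\<alpha> - 1)\<close> and \<open>(x - a) powr (\<alpha> - 1)\<close> of the two Riemann-Liouville integrals;
  moreover \<open>k\<close> vanishes at both endpoints, while \<open>k'\<close> takes the values
  \<open>\<plusminus>(\<alpha> + 1) (b - a) powr \<alpha>\<close> there. Two integrations by parts, done at once by integrating the
  derivative of \<open>k f' - k' f\<close>, therefore express the integral of \<open>k f''\<close> through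
  \<open>f a + f b\<close> and the two fractional integrals: this is \<open>fractional_trapezoid_identity\<close>.

  By \<open>trapezoid_kernel_nonneg\<close> the integral is, in absolute value, at most that of \<open>k \<bar>f''\<bar>\<close>, and
  \<open>s\<close>-convexity between the endpoints replaces \<open>\<bar>f''\<bar>\<close> by a combination of two powers of
  exponent \<open>s\<close>. What remains is a sum of Beta integrals, evaluated in
  \<open>has_integral_trapezoid_kernel_powr\<close>. The kernel is symmetric about the midpoint, so
  \<open>\<bar>f'' a\<bar>\<close> and \<open>\<bar>f'' b\<bar>\<close> receive the same coefficient, namely
  \<open>1 / (s + 1) - Beta (\<alpha> + 2) (s + 1) - 1 / (\<alpha> + s + 2)\<close> up to a power of \<open>b - a\<close>; the form in the
  theorem comes from splitting \<open>1 / (s + 1)\<close> as \<open>1 / (s + 2) + Beta 2 (s + 1)\<close> and merging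
  \<open>1 / (s + 2)\<close> with the last term.
\<close>

section \<open>Power and Beta integrals over an interval\<close>

text \<open>
  For \<open>-1 < p < 0\<close> the integrand is unbounded at \<open>a\<close>, but its antiderivative is continuous
  up to \<open>a\<close>, which is all that the fundamental theorem needs for the gauge integral.
\<close>
lemma has_integral_powr_left:
  fixes a b p :: real
  assumes "a \<le> b" "-1 < p"
  shows "((\<lambda>x. (x - a) powr p) has_integral (b - a) powr (p + 1) / (p + 1)) {a..b}"
proof -
  have "((\<lambda>x. (x - a) powr p) has_integral
          (b - a) powr (p + 1) / (p + 1) - (a - a) powr (p + 1) / (p + 1)) {a..b}"
  proof (rule fundamental_theorem_of_calculus_interior[OF \<open>a \<le> b\<close>])
    show "continuous_on {a..b} (\<lambda>x. (x - a) powr (p + 1) / (p + 1))"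
      using assms by (intro continuous_intros continuous_on_powr') auto
    show "((\<lambda>x. (x - a) powr (p + 1) / (p + 1)) has_vector_derivative (x - a) powr p) (at x)"
      if "x \<in> {a<..<b}" for x
      unfolding has_real_derivative_iff_has_vector_derivative[symmetric]
      using that assms by (auto intro!: derivative_eq_intros)
  qed
  then show ?thesis by simp
qed

lemma has_integral_powr_right:
  fixes a b p :: real
  assumes "a \<le> b" "-1 < p"
  shows "((\<lambda>x. (b - x) powr p) has_integral (b - a) powr (p + 1) / (p + 1)) {a..b}"
  using has_integral_reflect_lemma_real[OF has_integral_powr_left[of "-b" "-a" p]] assms
  by simp

lemma has_integral_Beta_interval:
  fixes a b p q :: real
  assumes "a < b" "0 < p" "0 < q"
  shows "((\<lambda>x. (x - a) powr (p - 1) * (b - x) powr (q - 1)) has_integral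
            (b - a) powr (p + q - 1) * Beta p q) {a..b}"
proof -
  define d where "d = b - a"
  have d: "d > 0" using assms by (simp add: d_def)
  \<comment> \<open>Substitute \<open>t = (x - a) / d\<close> in Euler's integral over the unit interval.\<close>
  have "((\<lambda>x. (1/d * x + (- a / d)) powr (p - 1) * (1 - (1/d * x + (- a / d))) powr (q - 1))
      has_integral d * Beta p q) {a..b}"
  proof -
    have "(0 - (- a / d)) /\<^sub>R (1/d) = a" "(1 - (- a / d)) /\<^sub>R (1/d) = b"
      using d by (simp_all add: field_simps d_def)
    moreover have "Beta p q /\<^sub>R (1/d) ^ DIM(real) = d * Beta p q" by simp
    ultimately show ?thesis
      using has_integral_affinity'[OF has_integral_Beta_real[OF assms(2,3), folded box_real(2)],
          of "1/d" "- a / d"] d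
      by (simp only: box_real(2) real_scaleR_def zero_less_divide_1_iff simp_thms True_implies_equals)
  qed
  from has_integral_mult_right[OF this, of "d powr (p - 1) * d powr (q - 1)"]
  have "((\<lambda>x. (d powr (p - 1) * d powr (q - 1)) * ((1/d * x + (- a / d)) powr (p - 1) * (1 - (1/d * x + (- a / d))) powr (q - 1)))
      has_integral (d powr (p - 1) * d powr (q - 1)) * (d * Beta p q)) {a..b}" .
  moreover have "(d powr (p - 1) * d powr (q - 1)) * (d * Beta p q) = d powr (p + q - 1) * Beta p q"
    using d by (simp add: powr_diff powr_add field_simps)
  moreover have "(d powr (p - 1) * d powr (q - 1)) *
      ((1/d * x + (- a / d)) powr (p - 1) * (1 - (1/d * x + (- a / d))) powr (q - 1))
      = (x - a) powr (p - 1) * (b - x) powr (q - 1)" if "x \<in> {a..b}" for x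
  proof -
    have "1/d * x + (- a / d) = (x - a) / d"
      by (simp add: diff_divide_distrib)
    moreover have "1 - (x - a) / d = (d - (x - a)) / d"
      using d by (simp add: diff_divide_distrib)
    then have "1 - (x - a) / d = (b - x) / d"
      by (simp add: d_def)
    ultimately show ?thesis using that d by (simp add: powr_divide)
  qed
  ultimately show ?thesis
    unfolding d_def by (metis (no_types, lifting) has_integral_eq)
qed

section \<open>The Peano kernel of the fractional trapezoid rule\<close>

text \<open>
  For \<open>\<alpha> = 1\<close> this is \<open>2 (x - a) (b - x)\<close>, a multiple of the Peano kernel of the classical
  trapezoid rule.
\<close>
definition trapezoid_kernel :: "real \<Rightarrow> real \<Rightarrow> real \<Rightarrow> real \<Rightarrow> real" where
  "trapezoid_kernel \<alpha> a b x =
     (b - a) powr (\<alpha> + 1) - (x - a) powr (\<alpha> + 1) - (b - x) powr (\<alpha> + 1)"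

text \<open>
  Powers with exponent at least 1 are superadditive: one of the \<open>\<alpha> + 1\<close> factors is kept, and in
  the others both \<open>x - a\<close> and \<open>b - x\<close> are enlarged to \<open>b - a\<close>.
\<close>
lemma trapezoid_kernel_nonneg:
  assumes "0 < \<alpha>" "x \<in> {a..b}"
  shows "0 \<le> trapezoid_kernel \<alpha> a b x"
proof -
  have split: "u powr (\<alpha> + 1) = u powr \<alpha> * u" if "0 \<le> u" for u :: real
    using that assms by (simp add: powr_add)
  have "(x - a) powr \<alpha> * (x - a) + (b - x) powr \<alpha> * (b - x)
      \<le> (b - a) powr \<alpha> * (x - a) + (b - a) powr \<alpha> * (b - x)"
    using assms by (intro add_mono mult_right_mono powr_mono2) auto
  also have "\<dots> = (b - a) powr \<alpha> * (b - a)"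
    by (simp add: algebra_simps)
  finally show ?thesis
    using assms by (simp add: trapezoid_kernel_def split)
qed

lemma Gamma_plus1_pos: "Gamma (x + 1) = x * Gamma x" if "0 < x" for x :: real
  using that by (intro Gamma_plus1) (auto dest: nonpos_Ints_nonpos)

text \<open>
  Green's identity \<open>(k f' - k' f)' = k f'' - k'' f\<close>, integrated over \<open>{a..b}\<close>. For \<open>\<alpha> < 1\<close> the
  factor \<open>k''\<close> is unbounded at the endpoints, but \<open>k\<close> and \<open>k'\<close> are continuous there. Since the left
  side is integrable by the fundamental theorem and \<open>k'' f\<close> is a continuous function times an
  integrable weight, the integrability of \<open>k f''\<close> is part of the conclusion.
\<close>
lemma fractional_trapezoid_identity:
  fixes f f' f'' :: "real \<Rightarrow> real"
  assumes "a < b" "0 < \<alpha>"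
    and cont: "continuous_on {a..b} f" "continuous_on {a..b} f'"
    and deriv: "\<And>x. x \<in> {a<..<b} \<Longrightarrow> (f has_real_derivative f' x) (at x)"
               "\<And>x. x \<in> {a<..<b} \<Longrightarrow> (f' has_real_derivative f'' x) (at x)"
  shows "((\<lambda>x. trapezoid_kernel \<alpha> a b x * f'' x) has_integral
           (\<alpha> + 1) * ((b - a) powr \<alpha> * (f a + f b)
             - Gamma (\<alpha> + 1) * (rl_integral_left a \<alpha> f b + rl_integral_right b \<alpha> f a))) {a..b}"
proof -
  let ?k = "trapezoid_kernel \<alpha> a b"
  let ?k' = "\<lambda>x. (\<alpha> + 1) * ((b - x) powr \<alpha> - (x - a) powr \<alpha>)"
  let ?w = "\<lambda>x. (b - x) powr (\<alpha> - 1)" and ?v = "\<lambda>x. (x - a) powr (\<alpha> - 1)"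
  have weighted: "(\<lambda>x. w x * f x) absolutely_integrable_on {a..b}"
    if "(w has_integral c) {a..b}" "\<And>x. 0 \<le> w x" for w c
  proof -
    have "bounded (f ` {a..b})"
      using cont(1) compact_continuous_image compact_imp_bounded by blast
    moreover have "w absolutely_integrable_on {a..b}"
      using that by (intro nonnegative_absolutely_integrable_1) (auto simp: integrable_on_def)
    ultimately have "(\<lambda>x. f x * w x) absolutely_integrable_on {a..b}"
      using cont(1)
      by (intro absolutely_integrable_bounded_measurable_product_real
            continuous_imp_measurable_on_sets_lebesgue) auto
    then show ?thesis by (simp add: mult.commute)
  qed
  have iw: "(\<lambda>x. ?w x * f x) absolutely_integrable_on {a..b}"
    by (rule weighted, rule has_integral_powr_right) (use assms in auto)
  have iv: "(\<lambda>x. ?v x * f x) absolutely_integrable_on {a..b}"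
    by (rule weighted, rule has_integral_powr_left) (use assms in auto)
  \<comment> \<open>The factor \<open>\<alpha>\<close> of \<open>k''\<close> turns \<open>Gamma \<alpha>\<close>, the normalisation of the fractional integrals, into
    \<open>Gamma (\<alpha> + 1)\<close>.\<close>
  have G: "Gamma (\<alpha> + 1) = \<alpha> * Gamma \<alpha>" "Gamma \<alpha> \<noteq> 0"
    using Gamma_plus1_pos[OF \<open>0 < \<alpha>\<close>] Gamma_real_pos[OF \<open>0 < \<alpha>\<close>] by auto
  have left: "((\<lambda>x. ?w x * f x) has_integral Gamma \<alpha> * rl_integral_left a \<alpha> f b) {a..b}"
    using iw G(2) set_lebesgue_integral_eq_integral[OF iw] 
    by (simp add: rl_integral_left_def integrable_integral)
  have right: "((\<lambda>x. ?v x * f x) has_integral Gamma \<alpha> * rl_integral_right b \<alpha> f a) {a..b}"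
    using iv G(2) set_lebesgue_integral_eq_integral[OF iv]
    by (simp add: rl_integral_right_def integrable_integral)
  have "((\<lambda>x. ?k x * f'' x + (\<alpha> + 1) * \<alpha> * (?w x * f x + ?v x * f x)) has_integral
          (?k b * f' b - ?k' b * f b) - (?k a * f' a - ?k' a * f a)) {a..b}"
  proof (rule fundamental_theorem_of_calculus_interior)
    show "continuous_on {a..b} (\<lambda>x. ?k x * f' x - ?k' x * f x)"
    proof -
      have "continuous_on {a..b} (\<lambda>x. (x - a) powr p)" "continuous_on {a..b} (\<lambda>x. (b - x) powr p)"
        if "0 < p" for p
        using that by (intro continuous_on_powr' continuous_intros; simp)+
      then show ?thesis
        unfolding trapezoid_kernel_def using cont assms(2)
        by (intro continuous_on_diff continuous_on_mult continuous_on_const) auto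
    qed
    show "((\<lambda>x. ?k x * f' x - ?k' x * f x) has_vector_derivative
            ?k x * f'' x + (\<alpha> + 1) * \<alpha> * (?w x * f x + ?v x * f x)) (at x)"
      if x: "x \<in> {a<..<b}" for x
    proof -
      have pow: "((\<lambda>x. (x - a) powr p) has_real_derivative p * (x - a) powr (p - 1)) (at x)"
                "((\<lambda>x. (b - x) powr p) has_real_derivative - (p * (b - x) powr (p - 1))) (at x)" for p
        using x by (auto intro!: derivative_eq_intros)
      have k: "(?k has_real_derivative ?k' x) (at x)"
        unfolding trapezoid_kernel_def
        by (rule DERIV_cong[OF DERIV_diff[OF DERIV_diff[OF DERIV_const pow(1)] pow(2)]])
          (simp add: right_diff_distrib)
      have k': "(?k' has_real_derivative - ((\<alpha> + 1) * \<alpha> * (?w x + ?v x))) (at x)"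
        by (rule DERIV_cong[OF DERIV_cmult[OF DERIV_diff[OF pow(2) pow(1)]]])
          (simp add: algebra_simps)
      show ?thesis
        unfolding has_real_derivative_iff_has_vector_derivative[symmetric]
        by (rule DERIV_cong[OF DERIV_diff[OF DERIV_mult[OF k deriv(2)[OF x]]
                  DERIV_mult[OF k' deriv(1)[OF x]]]]) (simp add: algebra_simps)
    qed
  qed (use assms in auto)
  from has_integral_diff[OF this has_integral_mult_right[OF has_integral_add[OF left right],
        of "(\<alpha> + 1) * \<alpha>"]]
  show ?thesis
    unfolding G(1) using assms by (simp add: trapezoid_kernel_def algebra_simps)
qed

section \<open>Integrating the convexity bound\<close>

lemma Beta_two:
  fixes s :: real
  assumes "0 < s"
  shows "Beta 2 (s + 1) = 1 / ((s + 1) * (s + 2))"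
proof -
  have "Gamma (s + 3) = (s + 2) * ((s + 1) * Gamma (s + 1))"
    using Gamma_plus1_pos[of "s + 2"] Gamma_plus1_pos[of "s + 1"] assms by (simp add: add.assoc)
  moreover have "Gamma (2::real) = 1"
    using Gamma_fact[of 1, where ?'a = real] by simp
  moreover have "Gamma (s + 1) > 0"
    using assms by (intro Gamma_real_pos) auto
  ultimately show ?thesis
    by (simp add: Beta_def add.commute)
qed

text \<open>
  The weights at \<open>A\<close> and \<open>B\<close> are mirror images of each other and the kernel is symmetric, so both
  give the same value \<open>J\<close>, in which the three terms of the kernel contribute one summand each.
\<close>
lemma has_integral_trapezoid_kernel_powr:
  fixes s :: real
  assumes "a < b" "0 < \<alpha>" "0 < s"
  shows "((\<lambda>x. trapezoid_kernel \<alpha> a b x * (((b - x) / (b - a)) powr s * A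
                 + ((x - a) / (b - a)) powr s * B)) has_integral
           (b - a) powr (\<alpha> + 2) * (\<alpha> / ((s + 2) * (\<alpha> + s + 2))
             + Beta 2 (s + 1) - Beta (\<alpha> + 2) (s + 1)) * (A + B)) {a..b}"
proof -
  define d where "d = b - a"
  have d: "d > 0" using assms by (simp add: d_def)
  let ?C = "\<alpha> / ((s + 2) * (\<alpha> + s + 2)) + Beta 2 (s + 1) - Beta (\<alpha> + 2) (s + 1)"
  define J where "J = d powr (\<alpha> + 1) * (d powr (s + 1) / (s + 1))
      - d powr (\<alpha> + s + 2) * Beta (\<alpha> + 2) (s + 1) - d powr (\<alpha> + s + 2) / (\<alpha> + s + 2)"
  have J: "d powr (- s) * J = d powr (\<alpha> + 2) * ?C"
  proof -
    have e: "d powr (\<alpha> + 1) * d powr (s + 1) = d powr (\<alpha> + 2) * d powr s"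
      "d powr (\<alpha> + s + 2) = d powr (\<alpha> + 2) * d powr s"
      by (simp_all add: powr_add[symmetric] algebra_simps)
    have C: "?C = 1 / (s + 1) - Beta (\<alpha> + 2) (s + 1) - 1 / (\<alpha> + s + 2)"
    proof -
      have nz: "s + 1 \<noteq> 0" "s + 2 \<noteq> 0" "\<alpha> + s + 2 \<noteq> 0"
        using assms by linarith+
      have "\<alpha> / ((s + 2) * (\<alpha> + s + 2)) = 1 / (s + 2) - 1 / (\<alpha> + s + 2)"
        using nz by (simp add: divide_simps)
      moreover have "1 / (s + 2) + 1 / ((s + 1) * (s + 2)) = 1 / (s + 1)"
        using nz by (simp add: divide_simps)
      ultimately show ?thesis using assms by (simp add: Beta_two)
    qed
    have "J = d powr (\<alpha> + 2) * d powr s * ?C"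
      unfolding J_def C times_divide_eq_right e by (simp add: algebra_simps)
    moreover have "d powr (- s) * d powr s = 1"
      using d by (simp add: powr_add[symmetric])
    moreover have "d powr (- s) * (d powr (\<alpha> + 2) * d powr s * ?C)
        = d powr (- s) * d powr s * (d powr (\<alpha> + 2) * ?C)"
      by (simp only: ac_simps)
    ultimately show ?thesis by simp
  qed
  have R: "((\<lambda>x. trapezoid_kernel \<alpha> a b x * (b - x) powr s) has_integral J) {a..b}"
  proof -
    have "((\<lambda>x. d powr (\<alpha> + 1) * (b - x) powr s - (x - a) powr (\<alpha> + 1) * (b - x) powr s
              - (b - x) powr (\<alpha> + s + 1)) has_integral J) {a..b}"
      unfolding J_def d_def
      using has_integral_Beta_interval[of a b "\<alpha> + 2" "s + 1"]
        has_integral_powr_right[of a b s] has_integral_powr_right[of a b "\<alpha> + s + 1"] assms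
      by (intro has_integral_diff has_integral_mult_right) (simp_all add: algebra_simps)
    then show ?thesis
      by (simp add: trapezoid_kernel_def d_def left_diff_distrib powr_add[symmetric] algebra_simps)
  qed
  have L: "((\<lambda>x. trapezoid_kernel \<alpha> a b x * (x - a) powr s) has_integral J) {a..b}"
  proof -
    have "((\<lambda>x. d powr (\<alpha> + 1) * (x - a) powr s - (x - a) powr s * (b - x) powr (\<alpha> + 1)
              - (x - a) powr (\<alpha> + s + 1)) has_integral J) {a..b}"
      unfolding J_def d_def
      using has_integral_Beta_interval[of a b "s + 1" "\<alpha> + 2"] Beta_commute[of "s + 1" "\<alpha> + 2"]
        has_integral_powr_left[of a b s] has_integral_powr_left[of a b "\<alpha> + s + 1"] assms
      by (intro has_integral_diff has_integral_mult_right) (simp_all add: algebra_simps)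
    then show ?thesis
      by (simp add: trapezoid_kernel_def d_def left_diff_distrib powr_add[symmetric] algebra_simps)
  qed
  have "((\<lambda>x. d powr (- s) * A * (trapezoid_kernel \<alpha> a b x * (b - x) powr s)
          + d powr (- s) * B * (trapezoid_kernel \<alpha> a b x * (x - a) powr s)) has_integral
          d powr (- s) * A * J + d powr (- s) * B * J) {a..b}"
    by (intro has_integral_add has_integral_mult_right L R)
  moreover have "d powr (- s) * A * J + d powr (- s) * B * J = d powr (\<alpha> + 2) * ?C * (A + B)"
    unfolding J[symmetric] by (simp add: algebra_simps)
  moreover have "d powr (- s) * A * (trapezoid_kernel \<alpha> a b x * (b - x) powr s)
          + d powr (- s) * B * (trapezoid_kernel \<alpha> a b x * (x - a) powr s)
      = trapezoid_kernel \<alpha> a b x * (((b - x) / (b - a)) powr s * A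
                 + ((x - a) / (b - a)) powr s * B)" if "x \<in> {a..b}" for x
    using that d by (simp add: powr_divide powr_minus_divide d_def field_simps)
  ultimately show ?thesis
    unfolding d_def by (metis (no_types, lifting) has_integral_eq)
qed

lemma s_convex_on_le_endpoints:
  assumes "s_convex_on s S g" "a \<in> S" "b \<in> S" "a < b" "x \<in> {a..b}"
  shows "g x \<le> ((b - x) / (b - a)) powr s * g a + ((x - a) / (b - a)) powr s * g b"
proof -
  define u where "u = (b - x) / (b - a)"
  have u: "u \<in> {0..1}" "1 - u = (x - a) / (b - a)"
    using assms by (auto simp: u_def field_simps)
  have "u * a + (1 - u) * b = b - u * (b - a)" by (simp add: algebra_simps)
  also have "\<dots> = x" using assms by (simp add: u_def)
  finally show ?thesis
    using assms u unfolding s_convex_on_def by (metis u_def)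
qed

theorem theorem6:
  fixes I :: "real set" and f :: "real \<Rightarrow> real" and a b s \<alpha> :: real
  assumes "is_interval I"
    and "\<And>x. x \<in> interior I \<Longrightarrow> f differentiable (at x)"
    and "\<And>x. x \<in> interior I \<Longrightarrow> deriv f differentiable (at x)"
    and "a \<in> interior I" and "b \<in> interior I" and "a < b"
    and "set_integrable lebesgue {a..b} (deriv (deriv f))"
    and "0 < s" and "s \<le> 1"
    and "s_convex_on s (interior I) (\<lambda>x. \<bar>deriv (deriv f) x\<bar>)"
    and "\<alpha> > 0"
  shows "\<bar>(f a + f b) / 2
            - Gamma (\<alpha> + 1) / (2 * (b - a) powr \<alpha>)
                * (rl_integral_left a \<alpha> f b + rl_integral_right b \<alpha> f a)\<bar>
         \<le> (b - a)\<^sup>2 / (2 * (\<alpha> + 1))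
             * (\<alpha> / ((s + 2) * (\<alpha> + s + 2)) + Beta 2 (s + 1) - Beta (\<alpha> + 2) (s + 1))
             * (\<bar>deriv (deriv f) a\<bar> + \<bar>deriv (deriv f) b\<bar>)"
proof -
  let ?f'' = "deriv (deriv f)"
  let ?k = "trapezoid_kernel \<alpha> a b"
  let ?E = "(b - a) powr \<alpha> * (f a + f b)
      - Gamma (\<alpha> + 1) * (rl_integral_left a \<alpha> f b + rl_integral_right b \<alpha> f a)"
  let ?M = "(\<alpha> / ((s + 2) * (\<alpha> + s + 2)) + Beta 2 (s + 1) - Beta (\<alpha> + 2) (s + 1))
             * (\<bar>?f'' a\<bar> + \<bar>?f'' b\<bar>)"
  have "is_interval (interior I)"
    using assms(1) by (simp add: is_interval_convex_1 convex_interior)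
  then have sub: "{a..b} \<subseteq> interior I"
    using assms(4,5) by (meson atLeastAtMost_iff mem_is_interval_1_I subsetI)
  have d1: "(f has_real_derivative deriv f x) (at x)"
    and d2: "(deriv f has_real_derivative ?f'' x) (at x)" if "x \<in> {a..b}" for x
    using assms(2,3) sub that
    by (auto simp: DERIV_deriv_iff_real_differentiable)
  have I: "((\<lambda>x. ?k x * ?f'' x) has_integral (\<alpha> + 1) * ?E) {a..b}"
  proof (rule fractional_trapezoid_identity[OF assms(6,11)])
    show "continuous_on {a..b} f" "continuous_on {a..b} (deriv f)"
      using d1 d2 by (meson DERIV_isCont continuous_at_imp_continuous_on)+
  qed (use d1 d2 in auto)
  note B = has_integral_trapezoid_kernel_powr[OF assms(6,11,8), of "\<bar>?f'' a\<bar>" "\<bar>?f'' b\<bar>"]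
  have "norm ((\<alpha> + 1) * ?E) \<le> (b - a) powr (\<alpha> + 2) * ?M"
    unfolding integral_unique[OF I, symmetric] mult.assoc[symmetric] integral_unique[OF B, symmetric]
  proof (rule integral_norm_bound_integral)
    fix x assume x: "x \<in> {a..b}"
    show "norm (?k x * ?f'' x) \<le> ?k x * (((b - x) / (b - a)) powr s * \<bar>?f'' a\<bar>
        + ((x - a) / (b - a)) powr s * \<bar>?f'' b\<bar>)"
      using s_convex_on_le_endpoints[OF assms(10,4,5,6) x] trapezoid_kernel_nonneg[OF assms(11) x]
      by (simp add: abs_mult mult_left_mono)
  qed (use I B in \<open>auto simp: integrable_on_def\<close>)
  moreover have "(b - a) powr (\<alpha> + 2) = (b - a) powr \<alpha> * (b - a)\<^sup>2"
    using assms(6) by (simp add: powr_add)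
  ultimately have bound: "(\<alpha> + 1) * \<bar>?E\<bar> \<le> (b - a) powr \<alpha> * (b - a)\<^sup>2 * ?M"
    using assms(11) by (simp add: abs_mult)
  have pos: "0 < (b - a) powr \<alpha>" using assms(6) by simp
  have "(f a + f b) / 2 - Gamma (\<alpha> + 1) / (2 * (b - a) powr \<alpha>)
          * (rl_integral_left a \<alpha> f b + rl_integral_right b \<alpha> f a)
      = ?E / (2 * (b - a) powr \<alpha>)"
    using pos by (simp add: diff_divide_distrib)
  also have "\<bar>\<dots>\<bar> = ((\<alpha> + 1) * \<bar>?E\<bar>) / (2 * (\<alpha> + 1) * (b - a) powr \<alpha>)"
    using pos assms(11) by (simp add: abs_divide frac_eq_eq)
  also have "\<dots> \<le> ((b - a) powr \<alpha> * (b - a)\<^sup>2 * ?M) / (2 * (\<alpha> + 1) * (b - a) powr \<alpha>)"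
    using bound pos assms(11) by (intro divide_right_mono) auto
  also have "\<dots> = (b - a)\<^sup>2 / (2 * (\<alpha> + 1)) * ?M"
    using pos by simp
  finally show ?thesis by (simp only: mult.assoc)
qed

end
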